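(* Let $q$ be real with $0<|q|<1$, let $c\in\mathbb{R}$, $b<0$ and $\lambda\in\mathbb{R}$, and suppose that $1+\lambda q^k/b>0$ for all $k\ge1$. Let $\{P_k(x)\}$ and $\{P_k^*(x)\}$ be the solutions of $$xy_k(x)=y_{k+1}(x)+cq^ky_k(x)+\tfrac14\left(1+\lambda q^k/b\right)y_{k-1}(x),\qquad k>0,$$ with $P_0(x)=1$, $P_1(x)=x-c$ and $P_0^*(x)=0$, $P_1^*(x)=1$. Define $$F(\rho)=\sum_{m=0}^{\infty}\frac{(-\lambda q\rho/2bc;q)_m}{(q;q)_m(q\rho^2;q)_m}(-2c\rho)^m q^{\binom{m+1}{2}},\qquad G(\rho)=\sum_{m=0}^{\infty}\frac{(-\lambda q\rho/2bc;q)_m}{(q;q)_m(q\rho^2;q)_m}(-2c\rho)^m q^{\binom{m}{2}}.$$ For $x\in\mathbb{C}\setminus(-1,1)$ let $\rho=\rho(x)$ be the following root of $\rho^2-2x\rho+1=0$: if $x\notin[-1,1]$, $\rho$ is the root with $|\rho|<1$; if $x=1$, $\rho=1$; if $x=-1$, $\rho=-1$. Then, for all complex numbers $x\notin(-1,1)$ except possibly a finite set of points, the limit $$X(x)=\lim_{k\to\infty}\frac{P_k^*(x)}{P_k(x)}$$ exists and is given by $$X(x)=2\rho\,\frac{F(\rho)}{G(\rho)}.$$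
   Context: $q$-rising factorials: $(a;q)_0=1$, $(a;q)_n=(1-a)(1-aq)\cdots(1-aq^{n-1})$ for $n\ge1$. The expression $-\lambda q\rho/2bc$ means $-\lambda q\rho/(2bc)$. When $c=0$, the product $(-\lambda q\rho/2bc;q)_m(-2c\rho)^m$ is understood as its continuous extension $\rho^m\prod_{j=0}^{m-1}\left(-2c-\lambda q^{j+1}\rho/b\right)$. $X(x)$ is the value of the continued fraction ($J$-fraction) associated with the recurrence, with numerators $P_k^*$ and denominators $P_k$. *)

theory Defs
  imports "HOL-Analysis.Analysis"
begin

definition qrising :: "complex \<Rightarrow> complex \<Rightarrow> nat \<Rightarrow> complex" where
  "qrising a q n = (\<Prod>j<n. 1 - a * q ^ j)"

definition solves_recurrence ::
    "real \<Rightarrow> real \<Rightarrow> real \<Rightarrow> real \<Rightarrow> complex \<Rightarrow> (nat \<Rightarrow> complex) \<Rightarrow> bool" where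
  "solves_recurrence q b c lam x y \<longleftrightarrow>
     (\<forall>k>0. x * y k = y (k + 1) + of_real (c * q ^ k) * y k
                     + (1 / 4) * of_real (1 + lam * q ^ k / b) * y (k - 1))"

(* The product of the q-rising factorial (-lam q rho / (2 b c); q)_m and (-2 c rho)^m,
   extended continuously to c = 0; see numer_eq_prod. *)
definition numer :: "real \<Rightarrow> real \<Rightarrow> real \<Rightarrow> real \<Rightarrow> complex \<Rightarrow> nat \<Rightarrow> complex" where
  "numer q b c lam \<rho> m =
     (if c = 0
      then \<rho> ^ m * (\<Prod>j<m. - 2 * of_real c - of_real (lam * q ^ (j + 1)) * \<rho> / of_real b)
      else qrising (- of_real (lam * q) * \<rho> / of_real (2 * b * c)) (of_real q) m
           * (- 2 * of_real c * \<rho>) ^ m)"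

definition F_term :: "real \<Rightarrow> real \<Rightarrow> real \<Rightarrow> real \<Rightarrow> complex \<Rightarrow> nat \<Rightarrow> complex" where
  "F_term q b c lam \<rho> m =
     numer q b c lam \<rho> m
     / (qrising (of_real q) (of_real q) m * qrising (of_real q * \<rho>\<^sup>2) (of_real q) m)
     * of_real q ^ (Suc m choose 2)"

definition G_term :: "real \<Rightarrow> real \<Rightarrow> real \<Rightarrow> real \<Rightarrow> complex \<Rightarrow> nat \<Rightarrow> complex" where
  "G_term q b c lam \<rho> m =
     numer q b c lam \<rho> m
     / (qrising (of_real q) (of_real q) m * qrising (of_real q * \<rho>\<^sup>2) (of_real q) m)
     * of_real q ^ (m choose 2)"

definition F :: "real \<Rightarrow> real \<Rightarrow> real \<Rightarrow> real \<Rightarrow> complex \<Rightarrow> complex" where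
  "F q b c lam \<rho> = (\<Sum>m. F_term q b c lam \<rho> m)"

definition G :: "real \<Rightarrow> real \<Rightarrow> real \<Rightarrow> real \<Rightarrow> complex \<Rightarrow> complex" where
  "G q b c lam \<rho> = (\<Sum>m. G_term q b c lam \<rho> m)"

(* Meaningful only off the open interval (-1,1); see rho_root. *)
definition rho :: "complex \<Rightarrow> complex" where
  "rho x = (if x = 1 then 1 else if x = -1 then -1
            else (THE r. r\<^sup>2 - 2 * x * r + 1 = 0 \<and> norm r < 1))"

lemma numer_eq_prod:
  assumes "b \<noteq> 0"
  shows "numer q b c lam \<rho> m =
    \<rho> ^ m * (\<Prod>j<m. - 2 * of_real c - of_real (lam * q ^ (j + 1)) * \<rho> / of_real b)"
proof (cases "c = 0")
  case False
  have "(\<Prod>j<m. 1 - (- of_real (lam * q) * \<rho> / of_real (2 * b * c)) * of_real q ^ j)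
          * (- 2 * of_real c * \<rho>) ^ m
      = (\<Prod>j<m. (1 - (- of_real (lam * q) * \<rho> / of_real (2 * b * c)) * of_real q ^ j)
          * (- 2 * of_real c * \<rho>))"
    by (simp only: prod.distrib prod_constant card_lessThan power_mult_distrib)
  also have "\<dots> = (\<Prod>j<m. \<rho> * (- 2 * of_real c - of_real (lam * q ^ (j + 1)) * \<rho> / of_real b))"
    using False assms by (intro prod.cong refl) (simp add: field_simps)
  also have "\<dots> = \<rho> ^ m * (\<Prod>j<m. - 2 * of_real c - of_real (lam * q ^ (j + 1)) * \<rho> / of_real b)"
    by (simp only: prod.distrib) simp
  finally show ?thesis
    using False by (simp add: numer_def qrising_def)
qed (simp add: numer_def)

lemma summable_of_ratio_tendsto_0:
  fixes f r :: "nat \<Rightarrow> complex"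
  assumes step: "\<And>m. f (Suc m) = r m * f m" and lim: "r \<longlonglongrightarrow> 0"
  shows "summable f"
proof -
  obtain N where N: "\<And>m. m \<ge> N \<Longrightarrow> norm (r m) < 1 / 2"
    using LIMSEQ_D[OF lim, of "1/2"] by auto
  show ?thesis
  proof (rule summable_ratio_test[of "1/2" N])
    fix m assume "m \<ge> N"
    then show "norm (f (Suc m)) \<le> 1 / 2 * norm (f m)"
      unfolding step norm_mult by (intro mult_right_mono[OF less_imp_le[OF N]]) auto
  qed auto
qed

lemma summable_FG_aux:
  fixes Q B C L \<rho> :: complex
  assumes q: "norm Q < 1"
  shows "(\<lambda>m. \<rho> * (- 2 * C - L * Q ^ (m + 1) * \<rho> / B)
          / ((1 - Q * Q ^ m) * (1 - Q * \<rho>\<^sup>2 * Q ^ m)) * Q ^ m) \<longlonglongrightarrow> 0"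
proof -
  have 0: "(\<lambda>m. Q ^ m) \<longlonglongrightarrow> 0"
    using q by (rule LIMSEQ_power_zero)
  have "(\<lambda>m. \<rho> * (- 2 * C - L * (Q * Q ^ m) * \<rho> * inverse B)
          / ((1 - Q * Q ^ m) * (1 - Q * \<rho>\<^sup>2 * Q ^ m)) * Q ^ m)
        \<longlonglongrightarrow> \<rho> * (- 2 * C - L * (Q * 0) * \<rho> * inverse B)
          / ((1 - Q * 0) * (1 - Q * \<rho>\<^sup>2 * 0)) * 0"
    by (intro tendsto_intros 0) auto
  then show ?thesis by (simp add: divide_inverse)
qed

lemma summable_F_term:
  assumes "\<bar>q\<bar> < 1" "b \<noteq> 0"
  shows "summable (F_term q b c lam \<rho>)"
proof -
  let ?r = "\<lambda>m. \<rho> * (- 2 * of_real c - of_real lam * of_real q ^ (m + 1) * \<rho> / of_real b)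
          / ((1 - of_real q * of_real q ^ m) * (1 - of_real q * \<rho>\<^sup>2 * of_real q ^ m)) * of_real q ^ m"
  have lim: "?r \<longlonglongrightarrow> 0"
    using assms by (intro summable_FG_aux) auto
  have "(\<lambda>m. of_real q * ?r m) \<longlonglongrightarrow> 0"
    using tendsto_mult[OF tendsto_const lim, of "of_real q"] by simp
  moreover have "F_term q b c lam \<rho> (Suc m) = (of_real q * ?r m) * F_term q b c lam \<rho> m" for m
  proof -
    have "Suc (Suc m) choose 2 = Suc m + (Suc m choose 2)"
      by (simp add: numeral_2_eq_2)
    then show ?thesis
      by (simp add: F_term_def numer_eq_prod[OF assms(2)] qrising_def power_add
          divide_inverse mult_ac del: binomial_Suc_Suc)
  qed
  ultimately show ?thesis by (rule summable_of_ratio_tendsto_0[rotated])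
qed

lemma summable_G_term:
  assumes "\<bar>q\<bar> < 1" "b \<noteq> 0"
  shows "summable (G_term q b c lam \<rho>)"
proof -
  let ?r = "\<lambda>m. \<rho> * (- 2 * of_real c - of_real lam * of_real q ^ (m + 1) * \<rho> / of_real b)
          / ((1 - of_real q * of_real q ^ m) * (1 - of_real q * \<rho>\<^sup>2 * of_real q ^ m)) * of_real q ^ m"
  have lim: "?r \<longlonglongrightarrow> 0"
    using assms by (intro summable_FG_aux) auto
  moreover have "G_term q b c lam \<rho> (Suc m) = ?r m * G_term q b c lam \<rho> m" for m
  proof -
    have "Suc m choose 2 = m + (m choose 2)"
      by (simp add: numeral_2_eq_2)
    then show ?thesis
      by (simp add: G_term_def numer_eq_prod[OF assms(2)] qrising_def power_add
          divide_inverse mult_ac del: binomial_Suc_Suc)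
  qed
  ultimately show ?thesis by (rule summable_of_ratio_tendsto_0[rotated])
qed

lemma rho_ex1:
  fixes x :: complex
  assumes "x \<notin> complex_of_real ` {-1..1}"
  shows "\<exists>!r. r\<^sup>2 - 2 * x * r + 1 = 0 \<and> norm r < 1"
proof -
  define s where "s = x + csqrt (x\<^sup>2 - 1)"
  define t where "t = x - csqrt (x\<^sup>2 - 1)"
  have st: "s * t = 1"
    unfolding s_def t_def
    by (simp add: algebra_simps power2_eq_square[symmetric])
  have sum: "s + t = 2 * x" by (simp add: s_def t_def)
  have fac: "r\<^sup>2 - 2 * x * r + 1 = (r - s) * (r - t)" for r
    unfolding sum[symmetric] using st by (simp add: algebra_simps power2_eq_square)
  have nst: "norm s * norm t = 1" using st by (metis norm_mult norm_one)
  have ns: "norm s \<noteq> 1"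
  proof
    assume n: "norm s = 1"
    then have "s * cnj s = 1" by (simp add: complex_norm_square[symmetric])
    moreover have "s \<noteq> 0" using n by auto
    ultimately have "t = cnj s" using st by (metis mult_left_cancel)
    then have "2 * x = of_real (2 * Re s)" using sum by (simp add: complex_add_cnj)
    then have "x = of_real (Re s)" by simp
    moreover have "\<bar>Re s\<bar> \<le> 1" using abs_Re_le_cmod[of s] n by simp
    then have "Re s \<in> {-1..1}" by auto
    ultimately show False using assms by blast
  qed
  have "\<exists>!r. (r = s \<or> r = t) \<and> norm r < 1"
  proof (cases "norm s < 1")
    case True
    then have "\<not> norm t < 1"
      using nst mult_strict_mono[of "norm s" 1 "norm t" 1] by auto
    then show ?thesis using True by blast
  next
    case False
    then have "norm s > 1" using ns by simp
    then have "norm t < 1"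
      using nst mult_strict_mono[of 1 "norm s" 1 "norm t"] 
      by (metis less_1_mult mult_cancel_left1 norm_ge_zero not_less_iff_gr_or_eq)
    then show ?thesis using False by blast
  qed
  then show ?thesis by (simp add: fac)
qed

lemma rho_root:
  assumes "x \<notin> complex_of_real ` {-1<..<1}"
  shows "(rho x)\<^sup>2 - 2 * x * rho x + 1 = 0"
    and "x \<notin> complex_of_real ` {-1..1} \<Longrightarrow> norm (rho x) < 1"
proof -
  have *: "(rho x)\<^sup>2 - 2 * x * rho x + 1 = 0 \<and> norm (rho x) < 1"
    if "x \<notin> complex_of_real ` {-1..1}"
  proof -
    have "1 \<in> complex_of_real ` {-1..1}" "-1 \<in> complex_of_real ` {-1..1}"
      by (auto simp: image_iff intro: bexI[of _ 1] bexI[of _ "-1"])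
    then have "x \<noteq> 1" "x \<noteq> -1" using that by auto
    then show ?thesis using theI'[OF rho_ex1[OF that]] by (simp add: rho_def)
  qed
  show "x \<notin> complex_of_real ` {-1..1} \<Longrightarrow> norm (rho x) < 1" using * by blast
  show "(rho x)\<^sup>2 - 2 * x * rho x + 1 = 0"
  proof (cases "x \<in> complex_of_real ` {-1..1}")
    case True
    then have "x = 1 \<or> x = -1" using assms by (force simp: image_iff)
    then show ?thesis by (auto simp: rho_def)
  qed (use * in blast)
qed

end

theory Submission
  imports Defs "HOL-Complex_Analysis.Complex_Analysis"
begin

text \<open>
  Write \<open>x = (\<rho> + 1/\<rho>) / 2\<close> with \<open>0 < \<bar>\<rho>\<bar> < 1\<close>, and let \<open>\<Phi>(z) = \<Sum> g\<^sub>m z\<^sup>m\<close> be the power series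
  whose coefficients are the terms of \<open>G\<close>. It is entire, \<open>\<Phi>(1) = G(\<rho>)\<close> and \<open>\<Phi>(q) = F(\<rho>)\<close>. The ratio
  \<open>g\<^sub>m\<^sub>+\<^sub>1 / g\<^sub>m\<close> is such that \<open>\<Phi>\<close> satisfies a second order \<open>q\<close>-difference equation
  (lemma \<open>gseries_q_difference\<close>), and at the points \<open>z = q\<^sup>k\<close> this equation says that
  \<open>h\<^sub>k = \<Phi>(q\<^sup>k\<^sup>+\<^sup>1)\<close> solves the recurrence of the orthogonal polynomials up to a gauge factor: with
  \<open>A\<^sub>k = 1 + \<lambda> q\<^sup>k / b\<close>, the sequence \<open>(\<rho>/2)\<^sup>k A\<^sub>1 \<dots> A\<^sub>k h\<^sub>k\<close> is its recessive solution.

  For any solution \<open>y\<close> put \<open>p\<^sub>k = (2\<rho>)\<^sup>k y\<^sub>k\<close>. The Casoratian of \<open>y\<close> with the recessive solution,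
  freed of its trivial factors, is the quantity \<open>h\<^sub>k p\<^sub>k\<^sub>+\<^sub>1 - \<rho>\<^sup>2 A\<^sub>k\<^sub>+\<^sub>1 h\<^sub>k\<^sub>+\<^sub>1 p\<^sub>k\<close>, and it does not
  depend on \<open>k\<close> (lemma \<open>casoratian_const\<close>). Since \<open>h\<^sub>k \<rightarrow> \<Phi>(0) = 1\<close> and \<open>A\<^sub>k \<rightarrow> 1\<close>, this is a first order
  recurrence for \<open>p\<close> which is a contraction in the limit, because \<open>\<bar>\<rho>\<^sup>2\<bar> < 1\<close>; hence
  \<open>p\<^sub>k \<rightarrow> w / (1 - \<rho>\<^sup>2)\<close>, where \<open>w\<close> is the constant (lemma \<open>solution_asymptotics\<close>). The initial values
  give \<open>w = G(\<rho>)\<close> for the denominators and \<open>w = 2 \<rho> F(\<rho>)\<close> for the numerators, and the quotient of the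
  two limits is the claimed value, as soon as \<open>G(\<rho>) \<noteq> 0\<close>.

  The exceptional points are \<open>\<plusminus>1\<close>, where the contraction is lost, and the images of the zeros of \<open>G\<close> in
  the closed unit disc. The latter are finite in number: the denominators \<open>1 - q\<^sup>j \<rho>\<^sup>2\<close> with \<open>j \<ge> 1\<close>
  do not vanish for \<open>\<bar>\<rho>\<bar>\<^sup>2 < 1 / \<bar>q\<bar>\<close>, so \<open>G\<close> is holomorphic on a disc of radius larger than 1
  (lemma \<open>G_holomorphic\<close>), and \<open>G(0) = 1\<close>. Thus the zeros cannot accumulate, not even at the unit circle.
\<close>

section \<open>Asymptotically contracting first order recurrences\<close>

lemma tendsto_0_of_contraction:
  fixes u g :: "nat \<Rightarrow> real"
  assumes nonneg: "\<And>k. 0 \<le> u k" and r: "0 \<le> r" "r < 1"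
    and step: "\<forall>\<^sub>F k in sequentially. u (Suc k) \<le> r * u k + g k" and g: "g \<longlonglongrightarrow> 0"
  shows "u \<longlonglongrightarrow> 0"
proof (rule LIMSEQ_I)
  fix e :: real assume e: "0 < e"
  define d where "d = e / 2"
  have "\<forall>\<^sub>F k in sequentially. g k < (1 - r) * d"
    using order_tendstoD(2)[OF g, of "(1 - r) * d"] e r by (simp add: d_def)
  with step have "\<forall>\<^sub>F k in sequentially. u (Suc k) \<le> r * u k + (1 - r) * d"
    by eventually_elim simp
  then obtain N where N: "\<And>k. k \<ge> N \<Longrightarrow> u (Suc k) \<le> r * u k + (1 - r) * d"
    by (auto simp: eventually_sequentially)
  \<comment> \<open>The affine map of the bound has the fixed point \<open>d\<close>, so the excess over \<open>d\<close> decays geometrically.\<close>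
  have geo: "u (N + j) \<le> d + r ^ j * u N" for j
  proof (induction j)
    case 0
    then show ?case using e by (simp add: d_def)
  next
    case (Suc j)
    have "u (N + Suc j) \<le> r * u (N + j) + (1 - r) * d" using N[of "N + j"] by simp
    also have "\<dots> \<le> r * (d + r ^ j * u N) + (1 - r) * d"
      using Suc r by (intro add_mono mult_left_mono) auto
    finally show ?case by (simp add: algebra_simps)
  qed
  have "(\<lambda>j. r ^ j * u N) \<longlonglongrightarrow> 0 * u N"
    using r by (intro tendsto_intros LIMSEQ_power_zero) auto
  then have "\<forall>\<^sub>F j in sequentially. r ^ j * u N < d"
    using order_tendstoD(2)[of "\<lambda>j. r ^ j * u N" 0 sequentially d] e by (simp add: d_def)
  then obtain J where J: "\<And>j. j \<ge> J \<Longrightarrow> r ^ j * u N < d"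
    by (auto simp: eventually_sequentially)
  have "norm (u k - 0) < e" if "k \<ge> N + J" for k
  proof -
    have "J \<le> k - N" and k: "N + (k - N) = k" using that by auto
    then show ?thesis
      using geo[of "k - N"] J[of "k - N"] nonneg[of k] unfolding k by (simp add: d_def)
  qed
  then show "\<exists>no. \<forall>k\<ge>no. norm (u k - 0) < e" by blast
qed

text \<open>The limit is the fixed point of the limiting affine map \<open>p \<mapsto> a p + w\<close>, and the distance to it is
  contracted up to an error that tends to \<open>0\<close>.\<close>

lemma affine_recurrence_tendsto:
  fixes p \<alpha> \<beta> :: "nat \<Rightarrow> complex"
  assumes step: "\<forall>\<^sub>F k in sequentially. p (Suc k) = \<alpha> k * p k + \<beta> k"
    and \<alpha>: "\<alpha> \<longlonglongrightarrow> a" and \<beta>: "\<beta> \<longlonglongrightarrow> w" and a: "norm a < 1"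
  shows "p \<longlonglongrightarrow> w / (1 - a)"
proof -
  define l where "l = w / (1 - a)"
  have "a \<noteq> 1" using a by auto
  then have l: "w + (a - 1) * l = 0"
    by (simp add: l_def field_simps)
  obtain r where r: "norm a < r" "r < 1" using a dense by blast
  have r0: "0 \<le> r" using r norm_ge_zero[of a] by linarith
  have "(\<lambda>k. norm (\<beta> k + (\<alpha> k - 1) * l)) \<longlonglongrightarrow> norm (w + (a - 1) * l)"
    by (intro tendsto_intros \<alpha> \<beta>)
  then have err: "(\<lambda>k. norm (\<beta> k + (\<alpha> k - 1) * l)) \<longlonglongrightarrow> 0"
    by (simp add: l)
  have "\<forall>\<^sub>F k in sequentially. norm (\<alpha> k) < r"
    using order_tendstoD(2)[OF tendsto_norm[OF \<alpha>]] r by blast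
  with step have "\<forall>\<^sub>F k in sequentially.
      norm (p (Suc k) - l) \<le> r * norm (p k - l) + norm (\<beta> k + (\<alpha> k - 1) * l)"
  proof eventually_elim
    case (elim k)
    have "p (Suc k) - l = \<alpha> k * (p k - l) + (\<beta> k + (\<alpha> k - 1) * l)"
      using elim by (simp add: algebra_simps)
    then have "norm (p (Suc k) - l) \<le> norm (\<alpha> k) * norm (p k - l) + norm (\<beta> k + (\<alpha> k - 1) * l)"
      using norm_triangle_ineq[of "\<alpha> k * (p k - l)" "\<beta> k + (\<alpha> k - 1) * l"]
      by (simp only: norm_mult)
    moreover have "norm (\<alpha> k) * norm (p k - l) \<le> r * norm (p k - l)"
      using elim by (intro mult_right_mono) auto
    ultimately show ?case by linarith
  qed
  then have "(\<lambda>k. norm (p k - l)) \<longlonglongrightarrow> 0"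
    using tendsto_0_of_contraction[OF _ r0 r(2) _ err] by simp
  then show ?thesis
    unfolding l_def[symmetric] by (rule LIM_zero_cancel[OF tendsto_norm_zero_cancel])
qed

section \<open>The generating series and its \<open>q\<close>-difference equation\<close>

lemma G_term_0 [simp]: "G_term q b c lam \<rho> 0 = 1"
  by (simp add: G_term_def numer_def qrising_def binomial_eq_0)

lemma G_term_Suc:
  assumes "b \<noteq> 0"
  shows "G_term q b c lam \<rho> (Suc m) =
    \<rho> * (- 2 * of_real c - of_real lam * of_real q ^ (m + 1) * \<rho> / of_real b)
      / ((1 - of_real q * of_real q ^ m) * (1 - of_real q * \<rho>\<^sup>2 * of_real q ^ m)) * of_real q ^ m
    * G_term q b c lam \<rho> m"
proof -
  have "Suc m choose 2 = m + (m choose 2)"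
    by (simp add: numeral_2_eq_2)
  then show ?thesis
    by (simp add: G_term_def numer_eq_prod[OF assms] qrising_def power_add
        divide_inverse mult_ac del: binomial_Suc_Suc)
qed

lemma F_term_eq_G_term: "F_term q b c lam \<rho> m = G_term q b c lam \<rho> m * of_real q ^ m"
proof -
  have "Suc m choose 2 = m + (m choose 2)"
    by (simp add: numeral_2_eq_2)
  then show ?thesis
    by (simp add: F_term_def G_term_def power_add mult_ac del: binomial_Suc_Suc)
qed

definition gseries :: "real \<Rightarrow> real \<Rightarrow> real \<Rightarrow> real \<Rightarrow> complex \<Rightarrow> complex \<Rightarrow> complex" where
  "gseries q b c lam \<rho> z = (\<Sum>m. G_term q b c lam \<rho> m * z ^ m)"

lemma gseries_1: "gseries q b c lam \<rho> 1 = G q b c lam \<rho>"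
  by (simp add: gseries_def G_def)

lemma gseries_q: "gseries q b c lam \<rho> (of_real q) = F q b c lam \<rho>"
  by (simp add: gseries_def F_def F_term_eq_G_term)

lemma gseries_0: "gseries q b c lam \<rho> 0 = 1"
  by (simp add: gseries_def)

lemma summable_gseries:
  assumes "\<bar>q\<bar> < 1" "b \<noteq> 0"
  shows "summable (\<lambda>m. G_term q b c lam \<rho> m * z ^ m)"
proof (rule summable_of_ratio_tendsto_0)
  let ?r = "\<lambda>m. \<rho> * (- 2 * of_real c - of_real lam * of_real q ^ (m + 1) * \<rho> / of_real b)
      / ((1 - of_real q * of_real q ^ m) * (1 - of_real q * \<rho>\<^sup>2 * of_real q ^ m)) * of_real q ^ m"
  show "G_term q b c lam \<rho> (Suc m) * z ^ Suc m = (z * ?r m) * (G_term q b c lam \<rho> m * z ^ m)" for m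
    by (simp add: G_term_Suc[OF assms(2)])
  show "(\<lambda>m. z * ?r m) \<longlonglongrightarrow> 0"
    using assms by (intro tendsto_mult_right_zero summable_FG_aux) auto
qed

lemma isCont_gseries:
  assumes "\<bar>q\<bar> < 1" "b \<noteq> 0"
  shows "isCont (gseries q b c lam \<rho>) z"
  using isCont_powser_converges_everywhere[OF summable_gseries[OF assms]]
  by (simp add: gseries_def[abs_def])

lemma one_minus_qpow_neq_0:
  fixes q :: real and \<rho> :: complex
  assumes "\<bar>q\<bar> < 1" "norm \<rho> \<le> 1"
  shows "1 - \<rho> * of_real q ^ Suc m \<noteq> 0"
proof
  assume "1 - \<rho> * of_real q ^ Suc m = 0"
  then have "norm (\<rho> * of_real q ^ Suc m) = 1" by simp
  moreover have "norm (\<rho> * of_real q ^ Suc m) \<le> 1 * \<bar>q\<bar> ^ Suc m"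
    unfolding norm_mult norm_power norm_of_real using assms by (intro mult_right_mono) auto
  moreover have "\<bar>q\<bar> ^ Suc m < 1" using assms by (simp add: power_less_one_iff del: power_Suc)
  ultimately show False by linarith
qed

text \<open>The left side minus the right side has the coefficients
  \<open>(1 + \<rho>\<^sup>2) q\<^sup>m - \<rho>\<^sup>2 q\<^sup>2\<^sup>m - 1 = - (1 - q\<^sup>m) (1 - \<rho>\<^sup>2 q\<^sup>m)\<close> times \<open>g\<^sub>m\<close>, apart from the terms that carry
  a factor \<open>z\<close>. They vanish for \<open>m = 0\<close>, and otherwise cancel the denominator of \<open>g\<^sub>m / g\<^sub>m\<^sub>-\<^sub>1\<close>.\<close>

lemma gseries_q_difference:
  fixes q b c lam :: real and \<rho> z :: complex
  assumes q: "\<bar>q\<bar> < 1" and b: "b \<noteq> 0" and \<rho>: "norm \<rho> \<le> 1"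
  defines "\<Phi> \<equiv> gseries q b c lam \<rho>"
  shows "(1 + \<rho>\<^sup>2 - 2 * of_real c * \<rho> * z) * \<Phi> (of_real q * z) =
    \<rho>\<^sup>2 * (1 + of_real (lam * q / b) * z) * \<Phi> ((of_real q)\<^sup>2 * z) + \<Phi> z"
proof -
  define Q :: complex where "Q = of_real q"
  define g where "g = G_term q b c lam \<rho>"
  have sm: "(\<lambda>m. g m * w ^ m) sums \<Phi> w" for w
    unfolding g_def \<Phi>_def gseries_def by (intro summable_sums summable_gseries q b)
  have "norm (\<rho>\<^sup>2) \<le> 1" using \<rho> by (simp add: norm_power power_le_one)
  then have nz: "1 - Q * Q ^ m \<noteq> 0" "1 - Q * \<rho>\<^sup>2 * Q ^ m \<noteq> 0" for m
    using one_minus_qpow_neq_0[OF q, of 1 m] one_minus_qpow_neq_0[OF q, of "\<rho>\<^sup>2" m]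
    by (simp_all add: Q_def mult_ac)
  define t where "t = (\<lambda>m. (1 + \<rho>\<^sup>2) * (g m * (Q * z) ^ m) - \<rho>\<^sup>2 * (g m * (Q\<^sup>2 * z) ^ m) - g m * z ^ m)"
  have t_sums: "t sums ((1 + \<rho>\<^sup>2) * \<Phi> (Q * z) - \<rho>\<^sup>2 * \<Phi> (Q\<^sup>2 * z) - \<Phi> z)"
    unfolding t_def by (intro sums_diff sums_mult sm)
  have t: "t m = - g m * (1 - Q ^ m) * (1 - \<rho>\<^sup>2 * Q ^ m) * z ^ m" for m
    by (simp add: t_def power_mult_distrib power_even_eq algebra_simps power2_eq_square)
  have "t (Suc m) = z * (2 * of_real c * \<rho> * (g m * (Q * z) ^ m)
      + \<rho>\<^sup>2 * of_real (lam * q / b) * (g m * (Q\<^sup>2 * z) ^ m))" for m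
  proof -
    have g: "g (Suc m) * ((1 - Q * Q ^ m) * (1 - Q * \<rho>\<^sup>2 * Q ^ m)) =
        \<rho> * (- 2 * of_real c - of_real lam * Q ^ (m + 1) * \<rho> / of_real b) * Q ^ m * g m"
      unfolding g_def G_term_Suc[OF b] Q_def[symmetric] using nz[of m] by simp
    have "t (Suc m) = - (g (Suc m) * ((1 - Q * Q ^ m) * (1 - Q * \<rho>\<^sup>2 * Q ^ m))) * z ^ Suc m"
      by (simp add: t mult_ac)
    also have "\<dots> = z * (2 * of_real c * \<rho> * (g m * (Q * z) ^ m)
      + \<rho>\<^sup>2 * of_real (lam * q / b) * (g m * (Q\<^sup>2 * z) ^ m))"
      unfolding g by (simp add: power_mult_distrib power_even_eq algebra_simps power2_eq_square Q_def)
    finally show ?thesis .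
  qed
  then have "(\<lambda>m. t (Suc m)) sums (z * (2 * of_real c * \<rho> * \<Phi> (Q * z)
      + \<rho>\<^sup>2 * of_real (lam * q / b) * \<Phi> (Q\<^sup>2 * z)))"
    by (simp only:) (intro sums_mult sums_add sm)
  then have "t sums (z * (2 * of_real c * \<rho> * \<Phi> (Q * z)
      + \<rho>\<^sup>2 * of_real (lam * q / b) * \<Phi> (Q\<^sup>2 * z)))"
    by (subst (asm) sums_Suc_iff) (simp add: t)
  from sums_unique2[OF t_sums this] show ?thesis
    unfolding Q_def[symmetric] by (simp add: algebra_simps)
qed

section \<open>Asymptotics of the solutions of the recurrence\<close>

lemma gseries_qpow_recurrence:
  assumes "\<bar>q\<bar> < 1" "b \<noteq> 0" "norm \<rho> \<le> 1"
  shows "gseries q b c lam \<rho> (of_real q ^ k) =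
    (1 + \<rho>\<^sup>2 - 2 * of_real c * \<rho> * of_real q ^ k) * gseries q b c lam \<rho> (of_real q ^ Suc k)
    - \<rho>\<^sup>2 * of_real (1 + lam * q ^ Suc k / b) * gseries q b c lam \<rho> (of_real q ^ Suc (Suc k))"
  using gseries_q_difference[OF assms, of c "of_real q ^ k" lam]
  by (simp add: power2_eq_square mult_ac)

text \<open>The two recurrences, for \<open>h\<^sub>k = \<Phi>(q\<^sup>k\<^sup>+\<^sup>1)\<close> and for \<open>p\<^sub>k = (2\<rho>)\<^sup>k y\<^sub>k\<close>, have the same middle
  coefficient \<open>1 + \<rho>\<^sup>2 - 2 c \<rho> q\<^sup>k\<close>, which is eliminated between them.\<close>

lemma casoratian_const:
  fixes q b c lam :: real and x \<rho> :: complex and y :: "nat \<Rightarrow> complex"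
  assumes q: "\<bar>q\<bar> < 1" and b: "b \<noteq> 0" and \<rho>: "norm \<rho> \<le> 1"
    and x: "\<rho>\<^sup>2 - 2 * x * \<rho> + 1 = 0"
    and y: "solves_recurrence q b c lam x y"
  defines "\<Phi> \<equiv> gseries q b c lam \<rho>"
  defines "p \<equiv> (\<lambda>k. (2 * \<rho>) ^ k * y k)"
  shows "\<Phi> (of_real q ^ Suc k) * p (Suc k)
      - \<rho>\<^sup>2 * of_real (1 + lam * q ^ Suc k / b) * \<Phi> (of_real q ^ Suc (Suc k)) * p k
    = \<Phi> (of_real q) * p 1 - \<rho>\<^sup>2 * of_real (1 + lam * q / b) * \<Phi> (of_real q ^ 2) * p 0"
proof (induction k)
  case 0
  then show ?case by (simp add: power2_eq_square)
next
  case (Suc k)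
  define A where "A = (\<lambda>k. complex_of_real (1 + lam * q ^ k / b))"
  define M where "M = 1 + \<rho>\<^sup>2 - 2 * of_real c * \<rho> * of_real q ^ Suc k"
  have y_rec: "y (Suc (Suc k)) = x * y (Suc k) - of_real (c * q ^ Suc k) * y (Suc k) - A (Suc k) * y k / 4"
  proof -
    have "x * y (Suc k) = y (Suc (Suc k)) + of_real (c * q ^ Suc k) * y (Suc k) + 1 / 4 * A (Suc k) * y k"
      using y[unfolded solves_recurrence_def, rule_format, of "Suc k"] by (simp add: A_def)
    then show ?thesis by (simp add: algebra_simps)
  qed
  have x': "2 * x * \<rho> = 1 + \<rho>\<^sup>2" using x by (simp add: algebra_simps)
  have "p (Suc (Suc k)) = (2 * \<rho>) ^ Suc k * ((2 * x * \<rho>) * y (Suc k)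
      - 2 * \<rho> * of_real (c * q ^ Suc k) * y (Suc k) - 2 * \<rho> * A (Suc k) * y k / 4)"
    unfolding p_def y_rec by (simp add: algebra_simps)
  also have "\<dots> = M * p (Suc k) - \<rho>\<^sup>2 * A (Suc k) * p k"
    unfolding x' by (simp add: p_def M_def algebra_simps power2_eq_square)
  finally have p_rec: "p (Suc (Suc k)) = M * p (Suc k) - \<rho>\<^sup>2 * A (Suc k) * p k" .
  have h_rec: "\<Phi> (of_real q ^ Suc k) = M * \<Phi> (of_real q ^ Suc (Suc k))
      - \<rho>\<^sup>2 * A (Suc (Suc k)) * \<Phi> (of_real q ^ Suc (Suc (Suc k)))"
    unfolding \<Phi>_def M_def A_def by (rule gseries_qpow_recurrence[OF q b \<rho>])
  have "\<Phi> (of_real q ^ Suc (Suc k)) * p (Suc (Suc k))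
      - \<rho>\<^sup>2 * A (Suc (Suc k)) * \<Phi> (of_real q ^ Suc (Suc (Suc k))) * p (Suc k)
    = \<Phi> (of_real q ^ Suc k) * p (Suc k) - \<rho>\<^sup>2 * A (Suc k) * \<Phi> (of_real q ^ Suc (Suc k)) * p k"
    unfolding p_rec h_rec by (simp add: algebra_simps)
  with Suc.IH show ?case unfolding A_def by simp
qed

text \<open>Once \<open>h\<^sub>k \<noteq> 0\<close>, the constancy of the Casoratian expresses \<open>p\<^sub>k\<^sub>+\<^sub>1\<close> through \<open>p\<^sub>k\<close> by an affine map
  that converges to \<open>p \<mapsto> \<rho>\<^sup>2 p + w\<close>.\<close>

lemma solution_asymptotics:
  fixes q b c lam :: real and x \<rho> :: complex and y :: "nat \<Rightarrow> complex"
  assumes q: "\<bar>q\<bar> < 1" and b: "b \<noteq> 0" and \<rho>: "norm \<rho> < 1"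
    and x: "\<rho>\<^sup>2 - 2 * x * \<rho> + 1 = 0"
    and y: "solves_recurrence q b c lam x y"
  defines "\<Phi> \<equiv> gseries q b c lam \<rho>"
  shows "(\<lambda>k. (2 * \<rho>) ^ k * y k) \<longlonglongrightarrow>
    (\<Phi> (of_real q) * (2 * \<rho> * y 1) - \<rho>\<^sup>2 * of_real (1 + lam * q / b) * \<Phi> (of_real q ^ 2) * y 0)
      / (1 - \<rho>\<^sup>2)"
proof -
  define p where "p = (\<lambda>k. (2 * \<rho>) ^ k * y k)"
  define w where "w = \<Phi> (of_real q) * (2 * \<rho> * y 1)
    - \<rho>\<^sup>2 * of_real (1 + lam * q / b) * \<Phi> (of_real q ^ 2) * y 0"
  define h where "h = (\<lambda>k. \<Phi> (of_real q ^ Suc k))"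
  define A where "A = (\<lambda>k. complex_of_real (1 + lam * q ^ Suc k / b))"
  have cas: "h k * p (Suc k) - \<rho>\<^sup>2 * A k * h (Suc k) * p k = w" for k
    using casoratian_const[OF q b less_imp_le[OF \<rho>] x y, of k]
    by (simp only: p_def w_def h_def A_def \<Phi>_def power_0 power_one_right mult_1)
  have qpow: "(\<lambda>k. q ^ Suc k) \<longlonglongrightarrow> 0"
    using q by (intro LIMSEQ_Suc LIMSEQ_power_zero) auto
  have "(\<lambda>k. complex_of_real q ^ Suc k) \<longlonglongrightarrow> 0"
    using q by (intro LIMSEQ_Suc LIMSEQ_power_zero) auto
  then have "(\<lambda>k. gseries q b c lam \<rho> (of_real q ^ Suc k)) \<longlonglongrightarrow> gseries q b c lam \<rho> 0"
    by (rule isCont_tendsto_compose[OF isCont_gseries[OF q b]])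
  then have h: "h \<longlonglongrightarrow> 1" by (simp add: h_def \<Phi>_def gseries_0)
  have "A \<longlonglongrightarrow> of_real (1 + lam * 0 / b)"
    unfolding A_def using b by (intro tendsto_intros qpow) auto
  then have A: "A \<longlonglongrightarrow> 1" by simp
  have "\<forall>\<^sub>F k in sequentially. h k \<noteq> 0"
    using tendsto_imp_eventually_ne[OF h] by simp
  then have step: "\<forall>\<^sub>F k in sequentially. p (Suc k) = (\<rho>\<^sup>2 * A k * h (Suc k) / h k) * p k + w / h k"
  proof eventually_elim
    case (elim k)
    then show ?case using cas[of k] by (simp add: field_simps)
  qed
  have "(\<lambda>k. \<rho>\<^sup>2 * A k * h (Suc k) / h k) \<longlonglongrightarrow> \<rho>\<^sup>2 * 1 * 1 / 1"
    by (intro tendsto_intros A h LIMSEQ_Suc) auto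
  moreover have "(\<lambda>k. w / h k) \<longlonglongrightarrow> w / 1"
    by (intro tendsto_intros h) auto
  moreover have "norm (\<rho>\<^sup>2) < 1"
    using \<rho> by (simp add: norm_power abs_square_less_1)
  ultimately have "p \<longlonglongrightarrow> w / (1 - \<rho>\<^sup>2)"
    using affine_recurrence_tendsto[OF step] by simp
  then show ?thesis by (simp add: p_def w_def)
qed

section \<open>Finiteness of the zeros of \<open>G\<close>\<close>

text \<open>A majorant for the series of \<open>G\<close> that is uniform on the disc of radius \<open>r\<close>. The ratio of
  consecutive terms is \<open>q\<^sup>m\<close> times a bounded factor: its denominator stays away from \<open>0\<close> because
  \<open>\<bar>1 - q\<^sup>m\<^sup>+\<^sup>1 \<rho>\<^sup>2\<bar> \<ge> 1 - \<bar>q\<bar> r\<^sup>2\<close>, so that \<open>r > 1\<close> is possible.\<close>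

lemma G_term_bound:
  fixes q b c lam r :: real and \<rho> :: complex
  assumes q: "\<bar>q\<bar> < 1" and b: "b \<noteq> 0" and \<rho>: "norm \<rho> \<le> r" and r: "\<bar>q\<bar> * r\<^sup>2 < 1"
  shows "norm (G_term q b c lam \<rho> m) \<le>
    (\<Prod>j<m. r * (2 * \<bar>c\<bar> + \<bar>lam\<bar> * r / \<bar>b\<bar>) / ((1 - \<bar>q\<bar>) * (1 - \<bar>q\<bar> * r\<^sup>2)) * \<bar>q\<bar> ^ j)"
proof (induction m)
  case 0
  then show ?case by simp
next
  case (Suc m)
  have r0: "0 \<le> r" using \<rho> norm_ge_zero order_trans by blast
  have qm: "\<bar>q\<bar> ^ m \<le> 1" "\<bar>q\<bar> ^ (m + 1) \<le> 1" using q by (auto intro!: power_le_one mult_le_one)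
  have 1: "norm (- 2 * of_real c - of_real lam * of_real q ^ (m + 1) * \<rho> / of_real b)
      \<le> 2 * \<bar>c\<bar> + \<bar>lam\<bar> * r / \<bar>b\<bar>"
  proof -
    have "norm (- 2 * of_real c - of_real lam * of_real q ^ (m + 1) * \<rho> / of_real b)
      \<le> norm (- 2 * of_real c :: complex) + norm (of_real lam * of_real q ^ (m + 1) * \<rho> / of_real b)"
      by (rule norm_triangle_ineq4)
    also have "\<dots> = 2 * \<bar>c\<bar> + \<bar>lam\<bar> * (\<bar>q\<bar> ^ (m + 1) * norm \<rho>) / \<bar>b\<bar>"
      by (simp add: norm_mult norm_divide norm_power)
    also have "\<dots> \<le> 2 * \<bar>c\<bar> + \<bar>lam\<bar> * (1 * r) / \<bar>b\<bar>"
      using qm \<rho> r0 by (intro add_left_mono divide_right_mono mult_left_mono mult_mono) auto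
    finally show ?thesis by simp
  qed
  have 2: "1 - \<bar>q\<bar> \<le> norm (1 - of_real q * of_real q ^ m :: complex)"
  proof -
    have "norm (of_real q * of_real q ^ m :: complex) \<le> \<bar>q\<bar> * 1"
      unfolding norm_mult norm_power norm_of_real using qm by (intro mult_left_mono) auto
    then show ?thesis
      using norm_triangle_ineq2[of 1 "of_real q * of_real q ^ m :: complex"] by simp
  qed
  have 3: "1 - \<bar>q\<bar> * r\<^sup>2 \<le> norm (1 - of_real q * \<rho>\<^sup>2 * of_real q ^ m)"
  proof -
    have "norm (of_real q * \<rho>\<^sup>2 * of_real q ^ m) \<le> (\<bar>q\<bar> * r\<^sup>2) * 1"
      unfolding norm_mult norm_power norm_of_real using qm \<rho> r0
      by (intro mult_mono power_mono) auto
    then show ?thesis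
      using norm_triangle_ineq2[of 1 "of_real q * \<rho>\<^sup>2 * of_real q ^ m"] by simp
  qed
  let ?K = "r * (2 * \<bar>c\<bar> + \<bar>lam\<bar> * r / \<bar>b\<bar>) / ((1 - \<bar>q\<bar>) * (1 - \<bar>q\<bar> * r\<^sup>2))"
  have K: "0 \<le> ?K" using q r r0 by simp
  have num: "norm (\<rho> * (- 2 * of_real c - of_real lam * of_real q ^ (m + 1) * \<rho> / of_real b))
      \<le> r * (2 * \<bar>c\<bar> + \<bar>lam\<bar> * r / \<bar>b\<bar>)"
    unfolding norm_mult[of \<rho>] by (rule mult_mono[OF \<rho> 1 r0 norm_ge_zero])
  have den: "(1 - \<bar>q\<bar>) * (1 - \<bar>q\<bar> * r\<^sup>2)
      \<le> norm ((1 - of_real q * of_real q ^ m) * (1 - of_real q * \<rho>\<^sup>2 * of_real q ^ m))"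
    unfolding norm_mult[of "1 - of_real q * of_real q ^ m"] by (rule mult_mono[OF 2 3]) (use r in auto)
  have "norm (\<rho> * (- 2 * of_real c - of_real lam * of_real q ^ (m + 1) * \<rho> / of_real b)
      / ((1 - of_real q * of_real q ^ m) * (1 - of_real q * \<rho>\<^sup>2 * of_real q ^ m))) \<le> ?K"
    unfolding norm_divide by (rule frac_le[OF _ num _ den]) (use q r r0 in auto)
  then have "norm (\<rho> * (- 2 * of_real c - of_real lam * of_real q ^ (m + 1) * \<rho> / of_real b)
      / ((1 - of_real q * of_real q ^ m) * (1 - of_real q * \<rho>\<^sup>2 * of_real q ^ m)) * of_real q ^ m)
    \<le> ?K * \<bar>q\<bar> ^ m"
    unfolding norm_mult[of _ "of_real q ^ m"] norm_power norm_of_real by (rule mult_right_mono) simp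
  from mult_mono[OF this Suc.IH mult_nonneg_nonneg[OF K zero_le_power[OF abs_ge_zero]] norm_ge_zero]
  have "norm (G_term q b c lam \<rho> (Suc m)) \<le> ?K * \<bar>q\<bar> ^ m * (\<Prod>j<m. ?K * \<bar>q\<bar> ^ j)"
    by (simp only: G_term_Suc[OF b] norm_mult[of _ "G_term q b c lam \<rho> m"])
  also have "\<dots> = (\<Prod>j<Suc m. ?K * \<bar>q\<bar> ^ j)"
    by (simp only: prod.lessThan_Suc mult.commute[of "prod _ _"])
  finally show ?case .
qed

lemma summable_prod_geometric:
  fixes q K :: real
  assumes "\<bar>q\<bar> < 1"
  shows "summable (\<lambda>m. \<Prod>j<m. K * \<bar>q\<bar> ^ j)"
proof -
  have "(\<lambda>m. complex_of_real (K * \<bar>q\<bar> ^ m)) \<longlonglongrightarrow> of_real (K * 0)"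
    using assms by (intro tendsto_intros LIMSEQ_power_zero) auto
  then have "summable (\<lambda>m. complex_of_real (\<Prod>j<m. K * \<bar>q\<bar> ^ j))"
    by (intro summable_of_ratio_tendsto_0[of _ "\<lambda>m. complex_of_real (K * \<bar>q\<bar> ^ m)"]) simp_all
  then show ?thesis by (simp only: summable_of_real_iff)
qed

text \<open>The terms are rational functions without poles in the disc, and the majorant above makes the
  series converge uniformly there.\<close>

lemma G_holomorphic:
  fixes q b c lam r :: real
  assumes q: "\<bar>q\<bar> < 1" and b: "b \<noteq> 0" and r: "\<bar>q\<bar> * r\<^sup>2 < 1"
  shows "G q b c lam holomorphic_on ball 0 r"
proof (rule holomorphic_uniform_sequence)
  show "(\<lambda>\<rho>. \<Sum>m<n. G_term q b c lam \<rho> m) holomorphic_on ball 0 r" for n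
  proof (intro holomorphic_on_sum)
    fix m
    have nz: "1 - of_real q * \<rho>\<^sup>2 * of_real q ^ j \<noteq> 0" if "\<rho> \<in> ball 0 r" for j and \<rho> :: complex
    proof
      assume "1 - of_real q * \<rho>\<^sup>2 * of_real q ^ j = 0"
      then have "norm (of_real q * \<rho>\<^sup>2 * of_real q ^ j) = 1" by simp
      moreover have "norm (of_real q * \<rho>\<^sup>2 * of_real q ^ j) \<le> (\<bar>q\<bar> * r\<^sup>2) * 1"
        unfolding norm_mult norm_power norm_of_real using that q
        by (intro mult_mono power_mono power_le_one) auto
      ultimately show False using r by linarith
    qed
    have nz1: "1 - of_real q * of_real q ^ j \<noteq> (0 :: complex)" for j
      using one_minus_qpow_neq_0[OF q, of 1 j] by simp
    show "(\<lambda>\<rho>. G_term q b c lam \<rho> m) holomorphic_on ball 0 r"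
      unfolding G_term_def numer_eq_prod[OF b] qrising_def
      using nz nz1 b by (intro holomorphic_intros) auto
  qed
next
  fix \<rho> :: complex assume "\<rho> \<in> ball 0 r"
  then obtain d where d: "d > 0" "cball \<rho> d \<subseteq> ball 0 r"
    using open_contains_cball[of "ball 0 r"] by blast
  have "uniform_limit (cball \<rho> d) (\<lambda>n \<rho>. \<Sum>m<n. G_term q b c lam \<rho> m)
      (\<lambda>\<rho>. \<Sum>m. G_term q b c lam \<rho> m) sequentially"
  proof (rule Weierstrass_m_test[OF _ summable_prod_geometric[OF q]])
    fix m \<rho>' assume "\<rho>' \<in> cball \<rho> d"
    then have "norm \<rho>' \<le> r" using d by (auto simp: subset_iff)
    from G_term_bound[OF q b this r]
    show "norm (G_term q b c lam \<rho>' m) \<le>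
      (\<Prod>j<m. r * (2 * \<bar>c\<bar> + \<bar>lam\<bar> * r / \<bar>b\<bar>) / ((1 - \<bar>q\<bar>) * (1 - \<bar>q\<bar> * r\<^sup>2)) * \<bar>q\<bar> ^ j)" .
  qed
  then show "\<exists>d>0. cball \<rho> d \<subseteq> ball 0 r \<and>
      uniform_limit (cball \<rho> d) (\<lambda>n \<rho>. \<Sum>m<n. G_term q b c lam \<rho> m) (G q b c lam) sequentially"
    using d by (auto simp: G_def[abs_def])
qed auto

text \<open>The closed unit disc is a compact subset of a larger open disc on which \<open>G\<close> is holomorphic, so
  infinitely many zeros would force \<open>G = 0\<close>, against \<open>G(0) = 1\<close>. The case of a constant \<open>G\<close> does occur
  (\<open>c = \<lambda> = 0\<close>) and has no zeros at all.\<close>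

lemma finite_zeros_G:
  fixes q b c lam :: real
  assumes q: "0 < \<bar>q\<bar>" "\<bar>q\<bar> < 1" and b: "b \<noteq> 0"
  shows "finite {\<rho> \<in> cball 0 1. G q b c lam \<rho> = 0}"
proof -
  obtain s where s: "1 < s" "s < 1 / \<bar>q\<bar>"
    using dense[of 1 "1 / \<bar>q\<bar>"] q by auto
  define r where "r = sqrt s"
  have r: "1 < r" "\<bar>q\<bar> * r\<^sup>2 < 1"
    using s q by (auto simp: r_def field_simps)
  have "numer q b c lam 0 (Suc m) = 0" for m
    by (simp add: numer_eq_prod[OF b])
  then have "G_term q b c lam 0 m = (if m = 0 then 1 else 0)" for m
    by (cases m) (simp_all add: G_term_def[of _ _ _ _ _ "Suc _"])
  then have "(\<lambda>m. G_term q b c lam 0 m) sums 1"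
    using sums_single[of 0 "\<lambda>_. 1 :: complex"] by (simp cong: if_cong)
  then have G0: "G q b c lam 0 = 1"
    by (simp add: G_def sums_iff)
  show ?thesis
  proof (cases "G q b c lam constant_on ball 0 r")
    case True
    then obtain a where a: "\<And>\<rho>. \<rho> \<in> ball 0 r \<Longrightarrow> G q b c lam \<rho> = a"
      by (auto simp: constant_on_def)
    have "G q b c lam \<rho> = 1" if "\<rho> \<in> cball 0 1" for \<rho>
      using a[of \<rho>] a[of 0] that G0 r by auto
    then have "{\<rho> \<in> cball 0 1. G q b c lam \<rho> = 0} = {}" by auto
    then show ?thesis by (metis finite.emptyI)
  next
    case False
    show ?thesis
      by (rule holomorphic_compact_finite_zeros[OF G_holomorphic[OF q(2) b r(2)] _ _ _ _ False])
        (use r in auto)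
  qed
qed

section \<open>The value of the continued fraction\<close>

theorem theorem4p1:
  fixes q b c lam :: real
    and P Pstar :: "nat \<Rightarrow> complex \<Rightarrow> complex"
  assumes "0 < \<bar>q\<bar>" and "\<bar>q\<bar> < 1"
    and "b < 0"
    and "\<And>k. k \<ge> 1 \<Longrightarrow> 1 + lam * q ^ k / b > 0"
    and "\<And>x. solves_recurrence q b c lam x (\<lambda>k. P k x)"
    and "\<And>x. P 0 x = 1" and "\<And>x. P 1 x = x - of_real c"
    and "\<And>x. solves_recurrence q b c lam x (\<lambda>k. Pstar k x)"
    and "\<And>x. Pstar 0 x = 0" and "\<And>x. Pstar 1 x = 1"
  shows "\<exists>S. finite S \<and>
    (\<forall>x. x \<notin> complex_of_real ` {-1<..<1} \<and> x \<notin> S \<longrightarrow>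
       (\<forall>\<^sub>F k in sequentially. P k x \<noteq> 0) \<and>
       G q b c lam (rho x) \<noteq> 0 \<and>
       (\<lambda>k. Pstar k x / P k x) \<longlonglongrightarrow>
         2 * rho x * (F q b c lam (rho x) / G q b c lam (rho x)))"
proof -
  define Z where "Z = {\<rho> \<in> cball 0 1. G q b c lam \<rho> = 0}"
  define S where "S = {1, -1} \<union> (\<lambda>\<rho>. (\<rho> + 1 / \<rho>) / 2) ` Z"
  have b: "b \<noteq> 0" using assms(3) by simp
  note q = assms(2)
  have "finite S"
    using finite_zeros_G[OF assms(1,2) b] by (simp add: S_def Z_def)
  moreover have "(\<forall>\<^sub>F k in sequentially. P k x \<noteq> 0) \<and> G q b c lam (rho x) \<noteq> 0 \<and>
      (\<lambda>k. Pstar k x / P k x) \<longlonglongrightarrow> 2 * rho x * (F q b c lam (rho x) / G q b c lam (rho x))"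
    if x: "x \<notin> complex_of_real ` {-1<..<1}" "x \<notin> S" for x
  proof -
    define \<rho> where "\<rho> = rho x"
    have "x \<notin> complex_of_real ` {-1..1}"
    proof
      assume "x \<in> complex_of_real ` {-1..1}"
      then have "x = 1 \<or> x = -1" using x(1) by (force simp: image_iff)
      then show False using x(2) by (auto simp: S_def)
    qed
    with rho_root[OF x(1)] have eq: "\<rho>\<^sup>2 - 2 * x * \<rho> + 1 = 0" and \<rho>: "norm \<rho> < 1"
      by (simp_all add: \<rho>_def)
    have \<rho>0: "\<rho> \<noteq> 0" using eq by auto
    then have "x = (\<rho> + 1 / \<rho>) / 2"
      using eq by (simp add: field_simps power2_eq_square)
    then have G: "G q b c lam \<rho> \<noteq> 0"
      using x(2) \<rho> by (auto simp: S_def Z_def)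
    have "norm (\<rho>\<^sup>2) < 1" using \<rho> by (simp add: norm_power abs_square_less_1)
    then have \<rho>2: "1 - \<rho>\<^sup>2 \<noteq> 0" by auto
    \<comment> \<open>The recurrence of \<open>\<Phi>\<close> at \<open>z = 1\<close> identifies the constant of the denominators.\<close>
    have "F q b c lam \<rho> * (2 * \<rho> * (x - of_real c))
        - \<rho>\<^sup>2 * of_real (1 + lam * q / b) * gseries q b c lam \<rho> (of_real q ^ 2)
      = F q b c lam \<rho> * (2 * x * \<rho> - 2 * of_real c * \<rho>)
        - \<rho>\<^sup>2 * of_real (1 + lam * q / b) * gseries q b c lam \<rho> (of_real q ^ 2)"
      by (simp add: algebra_simps)
    also have "2 * x * \<rho> = 1 + \<rho>\<^sup>2" using eq by (simp add: algebra_simps)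
    also have "F q b c lam \<rho> * (1 + \<rho>\<^sup>2 - 2 * of_real c * \<rho>)
        - \<rho>\<^sup>2 * of_real (1 + lam * q / b) * gseries q b c lam \<rho> (of_real q ^ 2) = G q b c lam \<rho>"
      using gseries_qpow_recurrence[OF q b less_imp_le[OF \<rho>], of c lam 0]
      by (simp add: gseries_1 gseries_q power2_eq_square mult_ac)
    finally have const: "F q b c lam \<rho> * (2 * \<rho> * (x - of_real c))
        - \<rho>\<^sup>2 * of_real (1 + lam * q / b) * gseries q b c lam \<rho> (of_real q ^ 2) = G q b c lam \<rho>" .
    have limP: "(\<lambda>k. (2 * \<rho>) ^ k * P k x) \<longlonglongrightarrow> G q b c lam \<rho> / (1 - \<rho>\<^sup>2)"
      using solution_asymptotics[OF q b \<rho> eq assms(5)]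
      unfolding assms(6,7) gseries_q mult_1_right const .
    have limPstar: "(\<lambda>k. (2 * \<rho>) ^ k * Pstar k x) \<longlonglongrightarrow> F q b c lam \<rho> * (2 * \<rho>) / (1 - \<rho>\<^sup>2)"
      using solution_asymptotics[OF q b \<rho> eq assms(8)]
      by (simp only: assms(9,10) gseries_q mult_1_right mult_zero_right diff_zero)
    have "\<forall>\<^sub>F k in sequentially. (2 * \<rho>) ^ k * P k x \<noteq> 0"
      by (rule tendsto_imp_eventually_ne[OF limP]) (use G \<rho>2 in simp)
    then have ev: "\<forall>\<^sub>F k in sequentially. P k x \<noteq> 0"
      by eventually_elim auto
    have "(\<lambda>k. ((2 * \<rho>) ^ k * Pstar k x) / ((2 * \<rho>) ^ k * P k x)) \<longlonglongrightarrow>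
        (F q b c lam \<rho> * (2 * \<rho>) / (1 - \<rho>\<^sup>2)) / (G q b c lam \<rho> / (1 - \<rho>\<^sup>2))"
      using G \<rho>2 by (intro tendsto_divide limP limPstar) auto
    then have "(\<lambda>k. Pstar k x / P k x) \<longlonglongrightarrow> 2 * \<rho> * (F q b c lam \<rho> / G q b c lam \<rho>)"
      using \<rho>0 \<rho>2 by (simp add: mult_ac)
    with ev G show ?thesis by (simp add: \<rho>_def)
  qed
  ultimately show ?thesis by blast
qed

end
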